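(* Let $i\in I$ and $0\neq t\in\mathbb{C}$, and let $n_i(t)=(\mathrm{id}_M+te_i)(\mathrm{id}_M-t^{-1}f_i)(\mathrm{id}_M+te_i)\in\mathrm{GL}(M)$. Then $n_i(t)^{-1}=n_i(-t)$ and, for all $\mu\in\Psi$, \[ n_i(t)(z_\mu)=\begin{cases} z_\mu & \text{if } (\mu,\alpha_i^\vee)=0,\\ -t^{-1}z_{\mu-\alpha_i} & \text{if } (\mu,\alpha_i^\vee)=1,\\ t\,z_{\mu+\alpha_i} & \text{if } (\mu,\alpha_i^\vee)=-1.\end{cases}\] Setting $n_i:=n_i(1)$, we have $n_i(z_\mu)=\pm z_{s_i(\mu)}$ and $n_i^2(z_\mu)=(-1)^{(\mu,\alpha_i^\vee)}z_\mu$ for all $\mu\in\Psi$; in particular, $n_i$ is represented (in the basis $\{z_\mu\mid \mu\in\Psi\}$) by a monomial matrix with non-zero entries equal to $\pm1$.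
   Context: $E$ is a finite-dimensional $\mathbb{Q}$-vector space with a symmetric bilinear form $(\,,\,)\colon E\times E\to\mathbb{Q}$ such that $(e,e)>0$ for $0\neq e\in E$; for $0\ne e\in E$ put $e^\vee=\frac{2}{(e,e)}e$. $\Phi\subseteq E$ is a reduced crystallographic irreducible root system spanning $E$, with simple roots $\{\alpha_i\mid i\in I\}$. $s_i(v)=v-(v,\alpha_i^\vee)\alpha_i$, and $W=\langle s_i\mid i\in I\rangle$ is the Weyl group. The weight lattice $\Lambda\subseteq E$ is the $\mathbb{Z}$-span of the basis of $E$ dual to $\{\alpha_i^\vee\mid i\in I\}$. A weight $\lambda\in\Lambda$ is dominant if $(\lambda,\alpha_i^\vee)\ge 0$ for all $i\in I$; a non-zero dominant $\lambda$ is minuscule if $(\lambda,\alpha^\vee)\in\{0,\pm1\}$ for all $\alpha\in\Phi$. $\Psi\subseteq\Lambda$ is a non-empty union of $W$-orbits of minuscule weights; thus $(\mu,\alpha^\vee)\in\{0,\pm1\}$ for all $\mu\in\Psi$, $\alpha\in\Phi$. $M$ is the $\mathbb{C}$-vector space with basis $\{z_\mu\mid\mu\in\Psi\}$. For $i\in I$ the linear maps $e_i,f_i\colon M\to M$ are defined by $e_i(z_\mu)=z_{\mu+\alpha_i}$ if $(\mu,\alpha_i^\vee)=-1$ and $e_i(z_\mu)=0$ otherwise; $f_i(z_\mu)=z_{\mu-\alpha_i}$ if $(\mu,\alpha_i^\vee)=1$ and $f_i(z_\mu)=0$ otherwise. One has $e_i^2=f_i^2=0$. *)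

theory Defs
  imports Complex_Main "HOL-Algebra.Bij" "HOL-Algebra.Generated_Groups"
begin

text \<open>A finite-dimensional rational vector space with a positive definite symmetric bilinear form.
  There is no type class for rational vector spaces, so scalar multiplication is a locale
  parameter.\<close>

locale rational_inner_space = vector_space scale
  for scale :: "rat \<Rightarrow> 'e::ab_group_add \<Rightarrow> 'e" +
  fixes ip :: "'e \<Rightarrow> 'e \<Rightarrow> rat"
  assumes fin_dim: "\<exists>B. finite B \<and> span B = UNIV"
    and ip_sym: "ip u v = ip v u"
    and ip_add: "ip (u + v) w = ip u w + ip v w"
    and ip_scale: "ip (scale c u) w = c * ip u w"
    and ip_pos: "u \<noteq> 0 \<Longrightarrow> ip u u > 0"
begin

definition coroot :: "'e \<Rightarrow> 'e" where
  "coroot a = scale (2 / ip a a) a"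

definition reflection :: "'e \<Rightarrow> 'e \<Rightarrow> 'e" where
  "reflection a v = v - scale (ip v (coroot a)) a"

end

text \<open>In \<open>irreducible\<close>, orthogonal \<open>A\<close> and \<open>B\<close> are automatically disjoint, as \<open>0 \<notin> \<Phi>\<close>.\<close>

locale root_system = rational_inner_space scale ip
  for scale :: "rat \<Rightarrow> 'e::ab_group_add \<Rightarrow> 'e" and ip :: "'e \<Rightarrow> 'e \<Rightarrow> rat" +
  fixes \<Phi> :: "'e set"
  assumes finite_roots: "finite \<Phi>"
    and zero_not_root: "0 \<notin> \<Phi>"
    and span_roots: "span \<Phi> = UNIV"
    and reflection_root: "\<lbrakk>a \<in> \<Phi>; b \<in> \<Phi>\<rbrakk> \<Longrightarrow> reflection a b \<in> \<Phi>"
    and crystallographic: "\<lbrakk>a \<in> \<Phi>; b \<in> \<Phi>\<rbrakk> \<Longrightarrow> ip b (coroot a) \<in> \<int>"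
    and reduced: "\<lbrakk>a \<in> \<Phi>; scale c a \<in> \<Phi>\<rbrakk> \<Longrightarrow> c = 1 \<or> c = - 1"
    and roots_nonempty: "\<Phi> \<noteq> {}"
    and irreducible: "\<lbrakk>\<Phi> = A \<union> B; \<forall>a\<in>A. \<forall>b\<in>B. ip a b = 0\<rbrakk> \<Longrightarrow> A = {} \<or> B = {}"

locale based_root_system = root_system scale ip \<Phi>
  for scale :: "rat \<Rightarrow> 'e::ab_group_add \<Rightarrow> 'e" and ip :: "'e \<Rightarrow> 'e \<Rightarrow> rat" and \<Phi> :: "'e set" +
  fixes I :: "'i set" and \<alpha> :: "'i \<Rightarrow> 'e"
  assumes simple_roots: "\<alpha> ` I \<subseteq> \<Phi>"
    and inj_simple: "inj_on \<alpha> I"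
    and independent_simple: "independent (\<alpha> ` I)"
    and root_expansion: "b \<in> \<Phi> \<Longrightarrow>
      \<exists>c :: 'i \<Rightarrow> int. b = (\<Sum>i\<in>I. scale (of_int (c i)) (\<alpha> i)) \<and>
        ((\<forall>i\<in>I. c i \<ge> 0) \<or> (\<forall>i\<in>I. c i \<le> 0))"
begin

definition weyl_group :: "('e \<Rightarrow> 'e) set" where
  "weyl_group = generate (BijGroup UNIV) ((\<lambda>i. reflection (\<alpha> i)) ` I)"

definition fundamental_weight :: "'i \<Rightarrow> 'e" where
  "fundamental_weight i =
    (THE w. \<forall>j\<in>I. ip w (coroot (\<alpha> j)) = (if i = j then 1 else 0))"

definition weight_lattice :: "'e set" where
  "weight_lattice =
    range (\<lambda>c :: 'i \<Rightarrow> int. \<Sum>i\<in>I. scale (of_int (c i)) (fundamental_weight i))"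

definition dominant :: "'e \<Rightarrow> bool" where
  "dominant l \<longleftrightarrow> l \<in> weight_lattice \<and> (\<forall>i\<in>I. ip l (coroot (\<alpha> i)) \<ge> 0)"

definition minuscule :: "'e \<Rightarrow> bool" where
  "minuscule l \<longleftrightarrow> dominant l \<and> l \<noteq> 0 \<and> (\<forall>a\<in>\<Phi>. ip l (coroot a) \<in> {0, 1, - 1})"

definition weyl_orbit :: "'e \<Rightarrow> 'e set" where
  "weyl_orbit l = (\<lambda>w. w l) ` weyl_group"

end

locale minuscule_weights = based_root_system scale ip \<Phi> I \<alpha>
  for scale :: "rat \<Rightarrow> 'e::ab_group_add \<Rightarrow> 'e" and ip :: "'e \<Rightarrow> 'e \<Rightarrow> rat" and \<Phi> :: "'e set"
    and I :: "'i set" and \<alpha> :: "'i \<Rightarrow> 'e" +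
  fixes \<Psi> :: "'e set"
  assumes Psi_nonempty: "\<Psi> \<noteq> {}"
    and Psi_union: "\<exists>L. L \<subseteq> {l. minuscule l} \<and> \<Psi> = (\<Union>l\<in>L. weyl_orbit l)"

text \<open>The space \<open>M\<close> is the whole type \<open>'m\<close>; the vectors \<open>z \<mu>\<close> with \<open>\<mu> \<in> \<Psi>\<close> are its basis, and
  the values of \<open>z\<close> outside \<open>\<Psi>\<close> are irrelevant. In the operators below, \<open>inv_into \<Psi> z b\<close> recovers
  the weight of a basis vector \<open>b\<close>.\<close>

locale minuscule_module =
  minuscule_weights scale ip \<Phi> I \<alpha> \<Psi> + M: vector_space_pair smult smult
  for scale :: "rat \<Rightarrow> 'e::ab_group_add \<Rightarrow> 'e" and ip :: "'e \<Rightarrow> 'e \<Rightarrow> rat" and \<Phi> :: "'e set"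
    and I :: "'i set" and \<alpha> :: "'i \<Rightarrow> 'e" and \<Psi> :: "'e set"
    and smult :: "complex \<Rightarrow> 'm::ab_group_add \<Rightarrow> 'm" +
  fixes z :: "'e \<Rightarrow> 'm"
  assumes inj_z: "inj_on z \<Psi>"
    and independent_z: "M.vs1.independent (z ` \<Psi>)"
    and span_z: "M.vs1.span (z ` \<Psi>) = UNIV"
begin

definition e_op :: "'i \<Rightarrow> 'm \<Rightarrow> 'm" where
  "e_op i = M.construct (z ` \<Psi>) (\<lambda>b. let \<mu> = inv_into \<Psi> z b in
     if ip \<mu> (coroot (\<alpha> i)) = - 1 then z (\<mu> + \<alpha> i) else 0)"

definition f_op :: "'i \<Rightarrow> 'm \<Rightarrow> 'm" where
  "f_op i = M.construct (z ` \<Psi>) (\<lambda>b. let \<mu> = inv_into \<Psi> z b in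
     if ip \<mu> (coroot (\<alpha> i)) = 1 then z (\<mu> - \<alpha> i) else 0)"

definition n_op :: "'i \<Rightarrow> complex \<Rightarrow> 'm \<Rightarrow> 'm" where
  "n_op i t = (\<lambda>v. v + smult t (e_op i v)) \<circ> (\<lambda>v. v - smult (inverse t) (f_op i v))
     \<circ> (\<lambda>v. v + smult t (e_op i v))"

text \<open>The \<open>(\<nu>, \<mu>)\<close> entry of the matrix of \<open>T\<close> in the basis \<open>z\<close>, for \<open>\<nu>, \<mu> \<in> \<Psi>\<close>.\<close>

definition matrix_of :: "('m \<Rightarrow> 'm) \<Rightarrow> 'e \<Rightarrow> 'e \<Rightarrow> complex" where
  "matrix_of T \<nu> \<mu> = M.vs1.representation (z ` \<Psi>) (T (z \<mu>)) (z \<nu>)"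

end

definition monomial_matrix :: "'a set \<Rightarrow> ('a \<Rightarrow> 'a \<Rightarrow> 'c::zero) \<Rightarrow> bool" where
  "monomial_matrix S A \<longleftrightarrow>
    (\<forall>\<nu>\<in>S. \<exists>!\<mu>. \<mu> \<in> S \<and> A \<nu> \<mu> \<noteq> 0) \<and> (\<forall>\<mu>\<in>S. \<exists>!\<nu>. \<nu> \<in> S \<and> A \<nu> \<mu> \<noteq> 0)"


subsection \<open>Consistency of the definitions\<close>

text \<open>The fundamental weights are well defined, \<open>\<Psi>\<close> is stable under the Weyl group, and the
  operators have the intended values on the basis.\<close>

context rational_inner_space
begin

lemma ip_add_right: "ip w (u + v) = ip w u + ip w v"
  using ip_add ip_sym by metis

lemma ip_scale_right: "ip w (scale c u) = c * ip w u"
  using ip_scale ip_sym by metis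

lemma ip_zero [simp]: "ip 0 w = 0" "ip w 0 = 0"
  using ip_scale[of 0 0 w] ip_scale_right[of w 0 0] by simp_all

lemma ip_minus: "ip (- u) w = - ip u w" "ip w (- u) = - ip w u"
  using ip_add[of u "- u" w] ip_add_right[of w u "- u"] by simp_all

lemma ip_diff: "ip (u - v) w = ip u w - ip v w" "ip w (u - v) = ip w u - ip w v"
  using ip_add[of u "- v" w] ip_add_right[of w u "- v"] by (simp_all add: ip_minus)

lemma ip_sum_right: "ip w (sum g A) = (\<Sum>x\<in>A. ip w (g x))"
  by (induction A rule: infinite_finite_induct) (simp_all add: ip_add_right)

lemma ip_coroot_self: "a \<noteq> 0 \<Longrightarrow> ip a (coroot a) = 2"
  using ip_pos[of a] by (simp add: coroot_def ip_scale_right)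

lemma reflection_involution: "a \<noteq> 0 \<Longrightarrow> reflection a (reflection a v) = v"
proof -
  assume "a \<noteq> 0"
  then have "ip (reflection a v) (coroot a) = - ip v (coroot a)"
    by (simp add: reflection_def ip_diff ip_scale ip_coroot_self)
  then show ?thesis by (simp add: reflection_def[of a "reflection a v"]) (simp add: reflection_def)
qed

lemma reflection_isometry: "a \<noteq> 0 \<Longrightarrow> ip (reflection a u) (reflection a v) = ip u v"
proof -
  assume "a \<noteq> 0"
  then have "ip a a \<noteq> 0" using ip_pos[of a] by simp
  then show ?thesis
    by (simp add: reflection_def coroot_def ip_diff ip_scale ip_scale_right ip_sym[of a v]
        divide_simps)
qed

lemma coroot_reflection: "a \<noteq> 0 \<Longrightarrow> ip (reflection a u) (coroot b) = ip u (coroot (reflection a b))"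
  using reflection_isometry[of a u "reflection a b"] reflection_isometry[of a b b]
  by (simp add: coroot_def ip_scale_right reflection_involution)

end

context based_root_system
begin

lemma simple_nonzero: "i \<in> I \<Longrightarrow> \<alpha> i \<noteq> 0"
  using simple_roots zero_not_root by auto

lemma finite_I: "finite I"
  using finite_subset[OF simple_roots finite_roots] inj_simple by (rule finite_imageD)

lemma fundamental_weight_unique:
  assumes "\<forall>j\<in>I. ip w (coroot (\<alpha> j)) = ip w' (coroot (\<alpha> j))"
  shows "w = w'"
proof -
  let ?d = "w - w'"
  have orth: "ip ?d (\<alpha> j) = 0" if "j \<in> I" for j
    using assms that simple_nonzero[OF that] ip_pos[of "\<alpha> j"]
    by (auto simp: coroot_def ip_scale_right ip_diff)
  have "\<Phi> \<subseteq> {v. ip ?d v = 0}"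
  proof
    fix b assume "b \<in> \<Phi>"
    then obtain c :: "'i \<Rightarrow> int" where "b = (\<Sum>i\<in>I. scale (of_int (c i)) (\<alpha> i))"
      using root_expansion by blast
    then show "b \<in> {v. ip ?d v = 0}"
      using orth by (simp add: ip_sum_right ip_scale_right)
  qed
  then have "span \<Phi> \<subseteq> {v. ip ?d v = 0}"
    by (rule span_minimal) (simp add: subspace_def ip_add_right ip_scale_right)
  then have "ip ?d ?d = 0" using span_roots by auto
  then show ?thesis using ip_pos[of ?d] by force
qed

lemma fundamental_weight:
  assumes "i \<in> I" "j \<in> I"
  shows "ip (fundamental_weight i) (coroot (\<alpha> j)) = (if i = j then 1 else 0)"
proof -
  interpret fd: finite_dimensional_vector_space scale "\<alpha> ` I"
  proof
    show "finite (\<alpha> ` I)" using finite_I by simp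
    show "independent (\<alpha> ` I)" by (rule independent_simple)
    have "\<Phi> \<subseteq> span (\<alpha> ` I)"
    proof
      fix b assume "b \<in> \<Phi>"
      then obtain c :: "'i \<Rightarrow> int" where "b = (\<Sum>i\<in>I. scale (of_int (c i)) (\<alpha> i))"
        using root_expansion by blast
      then show "b \<in> span (\<alpha> ` I)" by (simp add: span_base span_scale span_sum)
    qed
    then show "span (\<alpha> ` I) = UNIV" using span_mono span_roots span_span by (metis top.extremum_uniqueI)
  qed
  interpret p: vector_space_pair scale scale by unfold_locales
  define T where "T = (\<lambda>v. \<Sum>j\<in>I. scale (ip v (coroot (\<alpha> j))) (\<alpha> j))"
  have lin: "Vector_Spaces.linear scale scale T"
    by unfold_locales
      (simp_all add: T_def ip_add ip_scale scale_left_distrib sum.distrib scale_sum_right)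
  have coeff: "c j = d j" if "(\<Sum>j\<in>I. scale (c j) (\<alpha> j)) = (\<Sum>j\<in>I. scale (d j) (\<alpha> j))" "j \<in> I" for c d j
  proof -
    have "(\<Sum>v\<in>\<alpha> ` I. scale ((\<lambda>v. c (inv_into I \<alpha> v) - d (inv_into I \<alpha> v)) v) v) = 0"
      using that(1) by (simp add: sum.reindex[OF inj_simple] inv_into_f_f[OF inj_simple]
          scale_left_diff_distrib sum_subtractf)
    then have "c (inv_into I \<alpha> (\<alpha> j)) - d (inv_into I \<alpha> (\<alpha> j)) = 0"
      using independentD[OF independent_simple, of "\<alpha> ` I"
          "\<lambda>v. c (inv_into I \<alpha> v) - d (inv_into I \<alpha> v)" "\<alpha> j"] finite_I \<open>j \<in> I\<close> by simp
    then show ?thesis using \<open>j \<in> I\<close> by (simp add: inv_into_f_f[OF inj_simple])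
  qed
  have "inj T"
  proof (rule injI)
    fix x y assume "T x = T y"
    then have "\<forall>j\<in>I. ip x (coroot (\<alpha> j)) = ip y (coroot (\<alpha> j))"
      unfolding T_def by (intro ballI coeff)
    then show "x = y" by (rule fundamental_weight_unique)
  qed
  then have "surj T"
    using fd.linear_inj_imp_surj[OF lin] by blast
  then obtain w where w: "T w = \<alpha> i" by (metis surjD)
  have "\<alpha> i = (\<Sum>j\<in>I. scale (if i = j then 1 else 0) (\<alpha> j))"
    using finite_I \<open>i \<in> I\<close> by (simp add: if_distrib[of "\<lambda>c. scale c _"] cong: if_cong)
  then have eq: "(\<Sum>j\<in>I. scale (ip w (coroot (\<alpha> j))) (\<alpha> j)) =
      (\<Sum>j\<in>I. scale (if i = j then 1 else 0) (\<alpha> j))"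
    using w by (simp only: T_def)
  have "\<forall>j\<in>I. ip w (coroot (\<alpha> j)) = (if i = j then 1 else 0)"
    by (intro ballI coeff[OF eq])
  then have "\<forall>j\<in>I. ip (fundamental_weight i) (coroot (\<alpha> j)) = (if i = j then 1 else 0)"
    unfolding fundamental_weight_def
    by (rule theI[of _ w]) (rule fundamental_weight_unique, simp add: \<open>\<forall>j\<in>I. ip w _ = _\<close>)
  then show ?thesis using \<open>j \<in> I\<close> by blast
qed

lemma reflection_Bij: "i \<in> I \<Longrightarrow> reflection (\<alpha> i) \<in> carrier (BijGroup UNIV)"
proof -
  assume "i \<in> I"
  then have "reflection (\<alpha> i) \<circ> reflection (\<alpha> i) = id"
    by (simp add: fun_eq_iff reflection_involution simple_nonzero)
  then have "bij (reflection (\<alpha> i))" using o_bij by blast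
  then show ?thesis by (simp add: BijGroup_def Bij_def)
qed

lemma weyl_group_Bij: "w \<in> weyl_group \<Longrightarrow> w \<in> carrier (BijGroup UNIV)"
proof -
  have "(\<lambda>i. reflection (\<alpha> i)) ` I \<subseteq> carrier (BijGroup UNIV)"
    using reflection_Bij by (rule image_subsetI)
  from group.generate_incl[OF group_BijGroup this]
  show "w \<in> weyl_group \<Longrightarrow> w \<in> carrier (BijGroup UNIV)"
    unfolding weyl_group_def by (rule subsetD)
qed

lemma weyl_group_reflection: "i \<in> I \<Longrightarrow> w \<in> weyl_group \<Longrightarrow> reflection (\<alpha> i) \<circ> w \<in> weyl_group"
proof -
  assume i: "i \<in> I" and w: "w \<in> weyl_group"
  have "reflection (\<alpha> i) \<otimes>\<^bsub>BijGroup UNIV\<^esub> w \<in> weyl_group"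
    using i w unfolding weyl_group_def
    by (intro generate.eng[OF generate.incl]) auto
  moreover have "reflection (\<alpha> i) \<otimes>\<^bsub>BijGroup UNIV\<^esub> w = reflection (\<alpha> i) \<circ> w"
    using reflection_Bij[OF i] weyl_group_Bij[OF w] by (auto simp: BijGroup_def compose_def)
  ultimately show ?thesis by simp
qed

lemma inv_reflection: "i \<in> I \<Longrightarrow> inv\<^bsub>BijGroup UNIV\<^esub> (reflection (\<alpha> i)) = reflection (\<alpha> i)"
proof -
  assume i: "i \<in> I"
  have "reflection (\<alpha> i) \<otimes>\<^bsub>BijGroup UNIV\<^esub> reflection (\<alpha> i) = \<one>\<^bsub>BijGroup UNIV\<^esub>"
    using reflection_Bij[OF i] simple_nonzero[OF i]
    by (auto simp: BijGroup_def compose_def reflection_involution)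
  then show ?thesis
    using group.inv_equality[OF group_BijGroup] reflection_Bij[OF i] by blast
qed

lemma weyl_group_pairing:
  assumes "w \<in> weyl_group" "\<forall>a\<in>\<Phi>. ip l (coroot a) \<in> {0, 1, - 1}"
  shows "\<forall>a\<in>\<Phi>. ip (w l) (coroot a) \<in> {0, 1, - 1}"
proof -
  have step: "\<forall>a\<in>\<Phi>. ip (reflection (\<alpha> i) v) (coroot a) \<in> {0, 1, - 1}"
    if "i \<in> I" "\<forall>a\<in>\<Phi>. ip v (coroot a) \<in> {0, 1, - 1}" for i v
  proof
    fix a assume "a \<in> \<Phi>"
    moreover have "\<alpha> i \<in> \<Phi>" using that(1) simple_roots by blast
    ultimately have "reflection (\<alpha> i) a \<in> \<Phi>" by (simp add: reflection_root)
    then show "ip (reflection (\<alpha> i) v) (coroot a) \<in> {0, 1, - 1}"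
      using that(2) by (simp only: coroot_reflection[OF simple_nonzero[OF that(1)]])
  qed
  have "w \<in> generate (BijGroup UNIV) ((\<lambda>i. reflection (\<alpha> i)) ` I)"
    using assms(1) by (simp add: weyl_group_def)
  then have "\<forall>l. (\<forall>a\<in>\<Phi>. ip l (coroot a) \<in> {0, 1, - 1}) \<longrightarrow>
      (\<forall>a\<in>\<Phi>. ip (w l) (coroot a) \<in> {0, 1, - 1})"
  proof (induction)
    case one
    then show ?case by (simp add: BijGroup_def)
  next
    case (incl h)
    then show ?case using step by blast
  next
    case (inv h)
    then show ?case using step inv_reflection by fastforce
  next
    case (eng h1 h2)
    have "h1 \<in> weyl_group" "h2 \<in> weyl_group" using eng.hyps by (simp_all add: weyl_group_def)
    then have "h1 \<otimes>\<^bsub>BijGroup UNIV\<^esub> h2 = h1 \<circ> h2"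
      using weyl_group_Bij by (auto simp: BijGroup_def compose_def)
    then show ?case using eng.IH by (metis comp_apply)
  qed
  then show ?thesis using assms(2) by blast
qed

end

context minuscule_weights
begin

lemma pairing_Psi: "\<lbrakk>\<mu> \<in> \<Psi>; a \<in> \<Phi>\<rbrakk> \<Longrightarrow> ip \<mu> (coroot a) \<in> {0, 1, - 1}"
proof -
  assume "\<mu> \<in> \<Psi>" and a: "a \<in> \<Phi>"
  then obtain l w where l: "minuscule l" "w \<in> weyl_group" "\<mu> = w l"
    using Psi_union unfolding weyl_orbit_def by blast
  then show ?thesis
    using weyl_group_pairing[of w l] a by (simp add: minuscule_def)
qed

lemma reflection_Psi: "\<lbrakk>i \<in> I; \<mu> \<in> \<Psi>\<rbrakk> \<Longrightarrow> reflection (\<alpha> i) \<mu> \<in> \<Psi>"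
proof -
  assume i: "i \<in> I" and "\<mu> \<in> \<Psi>"
  then obtain L l w where L: "\<Psi> = (\<Union>l\<in>L. weyl_orbit l)" "l \<in> L" "w \<in> weyl_group" "\<mu> = w l"
    using Psi_union unfolding weyl_orbit_def by blast
  then have "reflection (\<alpha> i) \<mu> = (reflection (\<alpha> i) \<circ> w) l" by simp
  then show ?thesis
    using L weyl_group_reflection[OF i] unfolding weyl_orbit_def by blast
qed

end

context minuscule_module
begin

lemma linear_e_op: "Vector_Spaces.linear smult smult (e_op i)"
  unfolding e_op_def by (rule M.linear_construct[OF independent_z])

lemma linear_f_op: "Vector_Spaces.linear smult smult (f_op i)"
  unfolding f_op_def by (rule M.linear_construct[OF independent_z])

lemma e_op_z: "\<mu> \<in> \<Psi> \<Longrightarrow>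
    e_op i (z \<mu>) = (if ip \<mu> (coroot (\<alpha> i)) = - 1 then z (\<mu> + \<alpha> i) else 0)"
  by (simp add: e_op_def M.construct_basis[OF independent_z] inv_into_f_f[OF inj_z])

lemma f_op_z: "\<mu> \<in> \<Psi> \<Longrightarrow>
    f_op i (z \<mu>) = (if ip \<mu> (coroot (\<alpha> i)) = 1 then z (\<mu> - \<alpha> i) else 0)"
  by (simp add: f_op_def M.construct_basis[OF independent_z] inv_into_f_f[OF inj_z])

end

end

theory Submission
  imports Defs
begin

text \<open>On the basis vectors the claim is a rank-one \<open>SL\<^sub>2\<close> computation. A weight \<open>\<mu>\<close> pairs with
  \<open>\<alpha>\<^sub>i\<^sup>\<or>\<close> to \<open>0\<close>, \<open>1\<close> or \<open>-1\<close>, and \<open>s\<^sub>i\<close> fixes it, sends it to \<open>\<mu> - \<alpha>\<^sub>i\<close>, or sends it to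
  \<open>\<mu> + \<alpha>\<^sub>i\<close> accordingly, always staying in \<open>\<Psi>\<close>. Hence \<open>M\<close> is, for the pair \<open>e\<^sub>i, f\<^sub>i\<close>, a direct
  sum of trivial lines spanned by some \<open>z\<^sub>\<mu>\<close> and of planes spanned by some \<open>z\<^sub>\<mu>\<close> and \<open>z\<^sub>\<nu>\<close> with
  \<open>\<nu> = \<mu> - \<alpha>\<^sub>i\<close>, on which \<open>e\<^sub>i\<close> and \<open>f\<^sub>i\<close> are the two elementary nilpotent matrices. On a trivial
  line \<open>n\<^sub>i(t)\<close> is the identity; on such a plane it is the antidiagonal matrix with entries
  \<open>t\<close> and \<open>-t\<^sup>-\<^sup>1\<close> (lemma \<open>n_op_z\<close>).

  Everything else follows from that matrix. Two of them with parameters \<open>t\<close> and \<open>u\<close> multiply to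
  a diagonal matrix with entries \<open>-u/t\<close> and \<open>-t/u\<close> (lemma \<open>n_op_n_op_z\<close>): \<open>u = -t\<close> gives the
  inverse and \<open>u = t = 1\<close> gives the sign \<open>(-1)\<close> to the power \<open>(\<mu>, \<alpha>\<^sub>i\<^sup>\<or>)\<close>. At \<open>t = 1\<close> the entries are
  \<open>\<plusminus>1\<close>, so \<open>n\<^sub>i\<close> permutes the basis by \<open>s\<^sub>i\<close> up to sign, which makes its matrix monomial
  (lemma \<open>monomial_matrix_of\<close>).\<close>

context minuscule_module
begin

lemma pairing_cases:
  assumes "i \<in> I" "\<mu> \<in> \<Psi>"
  obtains "ip \<mu> (coroot (\<alpha> i)) = 0" | "ip \<mu> (coroot (\<alpha> i)) = 1" | "ip \<mu> (coroot (\<alpha> i)) = - 1"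
  using pairing_Psi[OF assms(2), of "\<alpha> i"] assms(1) simple_roots by blast

text \<open>The neighbouring weight is \<open>s\<^sub>i(\<mu>)\<close>, which is why it lies in \<open>\<Psi>\<close> and why its pairing has the
  opposite sign.\<close>

lemma lower_weight:
  assumes "i \<in> I" "\<mu> \<in> \<Psi>" "ip \<mu> (coroot (\<alpha> i)) = 1"
  shows "reflection (\<alpha> i) \<mu> = \<mu> - \<alpha> i" "\<mu> - \<alpha> i \<in> \<Psi>" "ip (\<mu> - \<alpha> i) (coroot (\<alpha> i)) = - 1"
proof -
  show eq: "reflection (\<alpha> i) \<mu> = \<mu> - \<alpha> i" using assms(3) by (simp add: reflection_def)
  show "\<mu> - \<alpha> i \<in> \<Psi>" using reflection_Psi[OF assms(1,2)] eq by simp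
  show "ip (\<mu> - \<alpha> i) (coroot (\<alpha> i)) = - 1"
    using assms(3) by (simp add: ip_diff ip_coroot_self simple_nonzero[OF assms(1)])
qed

lemma raise_weight:
  assumes "i \<in> I" "\<mu> \<in> \<Psi>" "ip \<mu> (coroot (\<alpha> i)) = - 1"
  shows "reflection (\<alpha> i) \<mu> = \<mu> + \<alpha> i" "\<mu> + \<alpha> i \<in> \<Psi>" "ip (\<mu> + \<alpha> i) (coroot (\<alpha> i)) = 1"
proof -
  show eq: "reflection (\<alpha> i) \<mu> = \<mu> + \<alpha> i" using assms(3) by (simp add: reflection_def)
  show "\<mu> + \<alpha> i \<in> \<Psi>" using reflection_Psi[OF assms(1,2)] eq by simp
  show "ip (\<mu> + \<alpha> i) (coroot (\<alpha> i)) = 1"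
    using assms(3) by (simp add: ip_add ip_coroot_self simple_nonzero[OF assms(1)])
qed

lemma linear_n_op: "Vector_Spaces.linear smult smult (n_op i t)"
proof -
  interpret e: Vector_Spaces.linear smult smult "e_op i" by (rule linear_e_op)
  interpret f: Vector_Spaces.linear smult smult "f_op i" by (rule linear_f_op)
  show ?thesis
    by unfold_locales
      (simp_all add: n_op_def e.add f.add e.diff f.diff e.scale f.scale
        M.vs1.scale_right_distrib M.vs1.scale_right_diff_distrib M.vs1.scale_left_commute algebra_simps)
qed

text \<open>When the pairing is \<open>1\<close>, the rightmost factor fixes \<open>z\<^sub>\<mu>\<close>, the middle one adds the multiple
  \<open>-t\<^sup>-\<^sup>1\<close> of its lower neighbour, and the leftmost one lifts that summand back to \<open>-z\<^sub>\<mu>\<close>, which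
  cancels \<open>z\<^sub>\<mu>\<close>. When it is \<open>-1\<close>, the cancellation already happens in the middle factor.\<close>

lemma n_op_z:
  assumes i: "i \<in> I" and t: "t \<noteq> 0" and \<mu>: "\<mu> \<in> \<Psi>"
  shows "ip \<mu> (coroot (\<alpha> i)) = 0 \<Longrightarrow> n_op i t (z \<mu>) = z \<mu>"
    and "ip \<mu> (coroot (\<alpha> i)) = 1 \<Longrightarrow> n_op i t (z \<mu>) = smult (- inverse t) (z (\<mu> - \<alpha> i))"
    and "ip \<mu> (coroot (\<alpha> i)) = - 1 \<Longrightarrow> n_op i t (z \<mu>) = smult t (z (\<mu> + \<alpha> i))"
proof -
  interpret e: Vector_Spaces.linear smult smult "e_op i" by (rule linear_e_op)
  interpret f: Vector_Spaces.linear smult smult "f_op i" by (rule linear_f_op)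
  note lin = e.add e.diff e.scale e.zero f.add f.diff f.scale f.zero
  show "n_op i t (z \<mu>) = z \<mu>" if "ip \<mu> (coroot (\<alpha> i)) = 0"
    using that \<mu> by (simp add: n_op_def e_op_z f_op_z)
  show "n_op i t (z \<mu>) = smult (- inverse t) (z (\<mu> - \<alpha> i))" if p: "ip \<mu> (coroot (\<alpha> i)) = 1"
    using p \<mu> t lower_weight[OF i \<mu> p]
    by (simp add: n_op_def e_op_z f_op_z lin M.vs1.scale_right_distrib)
  show "n_op i t (z \<mu>) = smult t (z (\<mu> + \<alpha> i))" if p: "ip \<mu> (coroot (\<alpha> i)) = - 1"
    using p \<mu> t raise_weight[OF i \<mu> p]
    by (simp add: n_op_def e_op_z f_op_z lin M.vs1.scale_right_distrib)
qed

lemma n_op_n_op_z: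
  assumes i: "i \<in> I" and t: "t \<noteq> 0" and u: "u \<noteq> 0" and \<mu>: "\<mu> \<in> \<Psi>"
  shows "ip \<mu> (coroot (\<alpha> i)) = 0 \<Longrightarrow> n_op i u (n_op i t (z \<mu>)) = z \<mu>"
    and "ip \<mu> (coroot (\<alpha> i)) = 1 \<Longrightarrow> n_op i u (n_op i t (z \<mu>)) = smult (- (u / t)) (z \<mu>)"
    and "ip \<mu> (coroot (\<alpha> i)) = - 1 \<Longrightarrow> n_op i u (n_op i t (z \<mu>)) = smult (- (t / u)) (z \<mu>)"
proof -
  interpret n: Vector_Spaces.linear smult smult "n_op i u" by (rule linear_n_op)
  show "n_op i u (n_op i t (z \<mu>)) = z \<mu>" if "ip \<mu> (coroot (\<alpha> i)) = 0"
    using that n_op_z(1)[OF i t \<mu>] n_op_z(1)[OF i u \<mu>] by simp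
  show "n_op i u (n_op i t (z \<mu>)) = smult (- (u / t)) (z \<mu>)" if p: "ip \<mu> (coroot (\<alpha> i)) = 1"
    using n_op_z(2)[OF i t \<mu> p] n_op_z(3)[OF i u lower_weight(2,3)[OF i \<mu> p]]
    by (simp add: n.scale n.neg divide_inverse mult.commute)
  show "n_op i u (n_op i t (z \<mu>)) = smult (- (t / u)) (z \<mu>)" if p: "ip \<mu> (coroot (\<alpha> i)) = - 1"
    using n_op_z(3)[OF i t \<mu> p] n_op_z(2)[OF i u raise_weight(2,3)[OF i \<mu> p]]
    by (simp add: n.scale divide_inverse)
qed

lemma n_op_inverse:
  assumes i: "i \<in> I" and t: "t \<noteq> 0"
  shows "n_op i (- t) (n_op i t v) = v"
proof -
  interpret n: Vector_Spaces.linear smult smult "n_op i t" by (rule linear_n_op)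
  interpret n': Vector_Spaces.linear smult smult "n_op i (- t)" by (rule linear_n_op)
  have lin: "Vector_Spaces.linear smult smult (\<lambda>v. n_op i (- t) (n_op i t v))"
    by unfold_locales (simp_all add: n.add n.scale n'.add n'.scale)
  have basis: "n_op i (- t) (n_op i t b) = b" if b: "b \<in> z ` \<Psi>" for b
  proof -
    obtain \<mu> where \<mu>: "\<mu> \<in> \<Psi>" "b = z \<mu>" using b by blast
    show ?thesis
      by (rule pairing_cases[OF i \<mu>(1)]) (use n_op_n_op_z[OF i t _ \<mu>(1), of "- t"] t \<mu>(2) in simp_all)
  qed
  show ?thesis
    by (rule M.linear_eq_on[OF lin M.vs1.linear_ident]) (use basis span_z in auto)
qed

lemma bij_n_op:
  assumes "i \<in> I" "t \<noteq> 0"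
  shows "bij (n_op i t)"
  using n_op_inverse[OF assms] n_op_inverse[of i "- t"] assms
  by (intro o_bij[of "n_op i (- t)"]) (auto simp: fun_eq_iff)

lemma inv_n_op:
  assumes "i \<in> I" "t \<noteq> 0"
  shows "inv_into UNIV (n_op i t) = n_op i (- t)"
  using n_op_inverse[OF assms] n_op_inverse[of i "- t"] assms
  by (intro inv_equality) auto

lemma n_op_one_z:
  assumes i: "i \<in> I" and \<mu>: "\<mu> \<in> \<Psi>"
  shows "n_op i 1 (z \<mu>) =
    smult (if ip \<mu> (coroot (\<alpha> i)) = 1 then - 1 else 1) (z (reflection (\<alpha> i) \<mu>))"
proof (rule pairing_cases[OF i \<mu>])
  assume p: "ip \<mu> (coroot (\<alpha> i)) = 0"
  then have "reflection (\<alpha> i) \<mu> = \<mu>" by (simp add: reflection_def)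
  then show ?thesis using n_op_z(1)[OF i _ \<mu> p] p by simp
next
  assume p: "ip \<mu> (coroot (\<alpha> i)) = 1"
  show ?thesis using n_op_z(2)[OF i _ \<mu> p, of 1] lower_weight(1)[OF i \<mu> p] p by simp
next
  assume p: "ip \<mu> (coroot (\<alpha> i)) = - 1"
  show ?thesis using n_op_z(3)[OF i _ \<mu> p, of 1] raise_weight(1)[OF i \<mu> p] p by simp
qed

lemma n_op_one_square_z:
  assumes i: "i \<in> I" and \<mu>: "\<mu> \<in> \<Psi>"
  shows "\<exists>k::int. ip \<mu> (coroot (\<alpha> i)) = of_int k \<and>
    n_op i 1 (n_op i 1 (z \<mu>)) = smult ((- 1) powi k) (z \<mu>)"
proof (rule pairing_cases[OF i \<mu>])
  assume p: "ip \<mu> (coroot (\<alpha> i)) = 0"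
  show ?thesis using n_op_n_op_z(1)[OF i _ _ \<mu> p, of 1 1] p by (intro exI[of _ 0]) simp
next
  assume p: "ip \<mu> (coroot (\<alpha> i)) = 1"
  show ?thesis using n_op_n_op_z(2)[OF i _ _ \<mu> p, of 1 1] p by (intro exI[of _ 1]) simp
next
  assume p: "ip \<mu> (coroot (\<alpha> i)) = - 1"
  show ?thesis using n_op_n_op_z(3)[OF i _ _ \<mu> p, of 1 1] p by (intro exI[of _ "- 1"]) simp
qed

lemma bij_betw_reflection_Psi:
  assumes "i \<in> I"
  shows "bij_betw (reflection (\<alpha> i)) \<Psi> \<Psi>"
  using assms by (intro bij_betw_byWitness[of _ "reflection (\<alpha> i)"])
    (auto simp: reflection_involution simple_nonzero reflection_Psi)

lemma matrix_of_scaled_basis: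
  assumes "\<kappa> \<in> \<Psi>" "\<nu> \<in> \<Psi>" "T (z \<mu>) = smult c (z \<kappa>)"
  shows "matrix_of T \<nu> \<mu> = (if \<nu> = \<kappa> then c else 0)"
  using assms inj_onD[OF inj_z, of \<kappa> \<nu>]
  by (auto simp: matrix_of_def M.vs1.representation_scale[OF independent_z] span_z
      M.vs1.representation_basis[OF independent_z])

lemma monomial_matrix_of:
  assumes \<sigma>: "bij_betw \<sigma> \<Psi> \<Psi>"
    and T: "\<And>\<mu>. \<mu> \<in> \<Psi> \<Longrightarrow> T (z \<mu>) = smult (c \<mu>) (z (\<sigma> \<mu>))"
    and c: "\<And>\<mu>. \<mu> \<in> \<Psi> \<Longrightarrow> c \<mu> \<noteq> 0"
  shows "monomial_matrix \<Psi> (matrix_of T)"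
proof -
  have in_Psi: "\<sigma> \<mu> \<in> \<Psi>" if "\<mu> \<in> \<Psi>" for \<mu> using \<sigma> that by (auto simp: bij_betw_def)
  have nz: "matrix_of T \<nu> \<mu> \<noteq> 0 \<longleftrightarrow> \<nu> = \<sigma> \<mu>" if "\<nu> \<in> \<Psi>" "\<mu> \<in> \<Psi>" for \<nu> \<mu>
    using matrix_of_scaled_basis[where T = T and \<mu> = \<mu>, OF in_Psi[OF that(2)] that(1) T[OF that(2)]] that c by simp
  have "\<exists>!\<mu>. \<mu> \<in> \<Psi> \<and> matrix_of T \<nu> \<mu> \<noteq> 0" if "\<nu> \<in> \<Psi>" for \<nu>
  proof -
    have "\<exists>!\<mu>. \<mu> \<in> \<Psi> \<and> \<nu> = \<sigma> \<mu>" using \<sigma> that by (auto simp: bij_betw_def inj_on_def)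
    then show ?thesis using nz[OF that] by metis
  qed
  moreover have "\<exists>!\<nu>. \<nu> \<in> \<Psi> \<and> matrix_of T \<nu> \<mu> \<noteq> 0" if "\<mu> \<in> \<Psi>" for \<mu>
    using nz[OF _ that] in_Psi[OF that] by metis
  ultimately show ?thesis by (simp add: monomial_matrix_def)
qed

end

theorem lemma3p1:
  fixes scale :: "rat \<Rightarrow> 'e::ab_group_add \<Rightarrow> 'e" and ip :: "'e \<Rightarrow> 'e \<Rightarrow> rat" and \<Phi> :: "'e set"
    and I :: "'i set" and \<alpha> :: "'i \<Rightarrow> 'e" and \<Psi> :: "'e set"
    and smult :: "complex \<Rightarrow> 'm::ab_group_add \<Rightarrow> 'm" and z :: "'e \<Rightarrow> 'm"
    and i :: 'i and t :: complex
  defines "n \<equiv> minuscule_module.n_op scale ip \<alpha> \<Psi> smult z i"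
    and "pair \<equiv> (\<lambda>\<mu>. ip \<mu> (rational_inner_space.coroot scale ip (\<alpha> i)))"
    and "s \<equiv> rational_inner_space.reflection scale ip (\<alpha> i)"
    and "A \<equiv> minuscule_module.matrix_of \<Psi> smult z"
  assumes "minuscule_module scale ip \<Phi> I \<alpha> \<Psi> smult z"
    and "i \<in> I" and "t \<noteq> 0"
  shows "(Vector_Spaces.linear smult smult (n t) \<and> bij (n t))
    \<and> inv_into UNIV (n t) = n (- t)
    \<and> (\<forall>\<mu>\<in>\<Psi>.
          (pair \<mu> = 0 \<longrightarrow> n t (z \<mu>) = z \<mu>)
        \<and> (pair \<mu> = 1 \<longrightarrow> n t (z \<mu>) = smult (- inverse t) (z (\<mu> - \<alpha> i)))
        \<and> (pair \<mu> = - 1 \<longrightarrow> n t (z \<mu>) = smult t (z (\<mu> + \<alpha> i))))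
    \<and> (\<forall>\<mu>\<in>\<Psi>. n 1 (z \<mu>) = z (s \<mu>) \<or> n 1 (z \<mu>) = - z (s \<mu>))
    \<and> (\<forall>\<mu>\<in>\<Psi>. \<exists>k::int. pair \<mu> = of_int k \<and> n 1 (n 1 (z \<mu>)) = smult ((- 1) powi k) (z \<mu>))
    \<and> monomial_matrix \<Psi> (A (n 1))
    \<and> (\<forall>\<nu>\<in>\<Psi>. \<forall>\<mu>\<in>\<Psi>. A (n 1) \<nu> \<mu> \<noteq> 0 \<longrightarrow> A (n 1) \<nu> \<mu> = 1 \<or> A (n 1) \<nu> \<mu> = - 1)"
proof -
  interpret minuscule_module scale ip \<Phi> I \<alpha> \<Psi> smult z by (rule assms(5))
  note i = \<open>i \<in> I\<close> and t = \<open>t \<noteq> 0\<close>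
  have defs: "n = n_op i" "pair = (\<lambda>\<mu>. ip \<mu> (coroot (\<alpha> i)))" "s = reflection (\<alpha> i)" "A = matrix_of"
    by (simp_all only: n_def pair_def s_def A_def)
  define c :: "'e \<Rightarrow> complex" where "c \<mu> = (if ip \<mu> (coroot (\<alpha> i)) = 1 then - 1 else 1)" for \<mu>
  have n1: "n_op i 1 (z \<mu>) = smult (c \<mu>) (z (reflection (\<alpha> i) \<mu>))" if "\<mu> \<in> \<Psi>" for \<mu>
    using n_op_one_z[OF i that] by (simp add: c_def)
  have c: "c \<mu> = 1 \<or> c \<mu> = - 1" for \<mu> by (simp add: c_def)
  have "n_op i 1 (z \<mu>) = z (reflection (\<alpha> i) \<mu>) \<or> n_op i 1 (z \<mu>) = - z (reflection (\<alpha> i) \<mu>)"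
    if "\<mu> \<in> \<Psi>" for \<mu>
    using n1[OF that] c[of \<mu>] by auto
  moreover have "monomial_matrix \<Psi> (matrix_of (n_op i 1))"
    by (rule monomial_matrix_of[OF bij_betw_reflection_Psi[OF i] n1]) (simp_all add: c_def)
  moreover have "matrix_of (n_op i 1) \<nu> \<mu> = 1 \<or> matrix_of (n_op i 1) \<nu> \<mu> = - 1"
    if "\<nu> \<in> \<Psi>" "\<mu> \<in> \<Psi>" "matrix_of (n_op i 1) \<nu> \<mu> \<noteq> 0" for \<nu> \<mu>
    using matrix_of_scaled_basis[where T = "n_op i 1" and \<mu> = \<mu>,
        OF reflection_Psi[OF i that(2)] that(1) n1[OF that(2)]] that(3) c[of \<mu>]
    by (auto split: if_splits)
  ultimately show ?thesis
    unfolding defs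
    using linear_n_op bij_n_op[OF i t] inv_n_op[OF i t] n_op_z[OF i t] n_op_one_square_z[OF i]
    by simp
qed

end
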